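(* Let $\alpha>0$ and let $\mathcal F$ be any collection of nonnegative error functions. (1) If $(\boldsymbol{\mathcal R}^{\mathrm{ER}_{\mathrm f}}_\alpha)_{\mathrm f\in\mathcal F}$ is a family of random collections of discovery sets with simultaneous error rate control over $\mathcal F$ at level $\alpha$, then there exists an e-collection $\mathbf E$ such that $\boldsymbol{\mathcal R}^{\mathrm{ER}_{\mathrm f}}_\alpha\subseteq\mathcal R^{\mathrm{ER}_{\mathrm f}}_\alpha(\mathbf E)$ for all $\mathrm f\in\mathcal F$. (2) For every e-collection $\mathbf E$, the family $(\mathcal R^{\mathrm{ER}_{\mathrm f}}_\alpha(\mathbf E))_{\mathrm f\in\mathcal F}$ provides simultaneous error rate control over $\mathcal F$ at level $\alpha$.
   Context: Setting: $M$ is a set of probability measures on a measurable space; $m\ge 1$, $[m]=\{1,\dots,m\}$; hypotheses $H_1,\dots,H_m\subseteq M$; for $\mathrm P\in M$, $N_{\mathrm P}=\{i\in[m]:\mathrm P\in H_i\}$. Random variables and random collections (values in $2^{2^{[m]}}$) are measurable functions on this space; random collections are assumed to be never empty (without loss, since $\emptyset$ may always be added). An error function $\mathrm f$ assigns to each pair $N,R\in 2^{[m]}$ a number $\mathrm f_N(R)\in[0,\infty)$, with $\mathrm f_N(\emptyset)=0$ for all $N$ and $\mathrm f_\emptyset(R)=0$ for all $R$. An e-collection is a family $\mathbf E=(\mathbf e_S)_{S\in 2^{[m]}}$ of nonnegative random variables (values in $[0,\infty]$ allowed) with $\mathbb E_{\mathrm P}(\mathbf e_{N_{\mathrm P}})\le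 1$ for all $\mathrm P\in M$; by convention $\mathbf e_\emptyset=0$. For an e-collection, $\mathcal R^{\mathrm{ER}_{\mathrm f}}_\alpha(\mathbf E)=\{R\in 2^{[m]}:\mathbf e_S\ge\mathrm f_S(R)/\alpha\ \text{for all }S\in 2^{[m]}\}$. A family $(\boldsymbol{\mathcal R}^{\mathrm{ER}_{\mathrm f}}_\alpha)_{\mathrm f\in\mathcal F}$ of random collections provides simultaneous error rate control over $\mathcal F$ at level $\alpha$ if $$\mathbb E_{\mathrm P}\Big[\sup_{\mathrm f\in\mathcal F}\max_{R\in\boldsymbol{\mathcal R}^{\mathrm{ER}_{\mathrm f}}_\alpha}\mathrm f_{N_{\mathrm P}}(R)\Big]\le\alpha\quad\text{for all }\mathrm P\in M.$$ For uncountable $\mathcal F$, suprema of the form $\sup_{\mathrm f\in\mathcal F}\max_{R}\mathrm f_S(R)$ over the collections considered ($S\in 2^{[m]}$) are assumed measurable, so that the expectations are well-defined. *)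

theory Defs
  imports "HOL-Probability.Probability"
begin

definition true_hyps :: "nat \<Rightarrow> (nat \<Rightarrow> 'w measure set) \<Rightarrow> 'w measure \<Rightarrow> nat set" where
  "true_hyps m H P = {i \<in> {1..m}. P \<in> H i}"

type_synonym error_fun = "nat set \<Rightarrow> nat set \<Rightarrow> real"

(* Only the values at subsets of {1..m} matter; the others are left unconstrained. *)
definition error_function :: "nat \<Rightarrow> error_fun \<Rightarrow> bool" where
  "error_function m f \<longleftrightarrow>
     (\<forall>N\<in>Pow {1..m}. \<forall>R\<in>Pow {1..m}. 0 \<le> f N R) \<and>
     (\<forall>N\<in>Pow {1..m}. f N {} = 0) \<and>
     (\<forall>R\<in>Pow {1..m}. f {} R = 0)"

definition random_collection :: "'w measure \<Rightarrow> nat \<Rightarrow> ('w \<Rightarrow> nat set set) \<Rightarrow> bool" where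
  "random_collection \<Omega> m C \<longleftrightarrow>
     C \<in> measurable \<Omega> (count_space (Pow (Pow {1..m}))) \<and>
     (\<forall>\<omega>\<in>space \<Omega>. C \<omega> \<noteq> {})"

definition e_collection ::
  "'w measure \<Rightarrow> 'w measure set \<Rightarrow> nat \<Rightarrow> (nat \<Rightarrow> 'w measure set) \<Rightarrow>
   (nat set \<Rightarrow> 'w \<Rightarrow> ennreal) \<Rightarrow> bool" where
  "e_collection \<Omega> M m H E \<longleftrightarrow>
     (\<forall>S\<in>Pow {1..m}. E S \<in> borel_measurable \<Omega>) \<and>
     (\<forall>\<omega>\<in>space \<Omega>. E {} \<omega> = 0) \<and>
     (\<forall>P\<in>M. (\<integral>\<^sup>+ \<omega>. E (true_hyps m H P) \<omega> \<partial>P) \<le> 1)"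

definition ER_collection ::
  "nat \<Rightarrow> real \<Rightarrow> (nat set \<Rightarrow> 'w \<Rightarrow> ennreal) \<Rightarrow> error_fun \<Rightarrow> 'w \<Rightarrow> nat set set" where
  "ER_collection m \<alpha> E f \<omega> =
     {R \<in> Pow {1..m}. \<forall>S\<in>Pow {1..m}. E S \<omega> \<ge> ennreal (f S R / \<alpha>)}"

(* The supremum is taken in [0, \<infinity>], so that it is 0 for an empty F. *)
definition sup_error ::
  "error_fun set \<Rightarrow> (error_fun \<Rightarrow> 'w \<Rightarrow> nat set set) \<Rightarrow> nat set \<Rightarrow> 'w \<Rightarrow> ennreal" where
  "sup_error F C S \<omega> = (SUP f\<in>F. ennreal (MAX R\<in>C f \<omega>. f S R))"

(* The nonnegative integral is also defined for non-measurable functions (as a lower integral),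
   so measurability of the suprema has to be required explicitly where it is not automatic. *)
definition measurable_suprema ::
  "'w measure \<Rightarrow> nat \<Rightarrow> error_fun set \<Rightarrow> (error_fun \<Rightarrow> 'w \<Rightarrow> nat set set) \<Rightarrow> bool" where
  "measurable_suprema \<Omega> m F C \<longleftrightarrow>
     (uncountable F \<longrightarrow> (\<forall>S\<in>Pow {1..m}. sup_error F C S \<in> borel_measurable \<Omega>))"

definition simultaneous_error_control ::
  "'w measure \<Rightarrow> 'w measure set \<Rightarrow> nat \<Rightarrow> (nat \<Rightarrow> 'w measure set) \<Rightarrow> real \<Rightarrow> error_fun set \<Rightarrow>
   (error_fun \<Rightarrow> 'w \<Rightarrow> nat set set) \<Rightarrow> bool" where
  "simultaneous_error_control \<Omega> M m H \<alpha> F C \<longleftrightarrow>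
     (\<forall>f\<in>F. random_collection \<Omega> m (C f)) \<and>
     (\<forall>P\<in>M. (\<integral>\<^sup>+ \<omega>. sup_error F C (true_hyps m H P) \<omega> \<partial>P) \<le> ennreal \<alpha>)"

end

theory Submission
  imports Defs
begin

text \<open>
  In (1), the rescaled worst-case errors \<open>sup_error F C S / \<alpha>\<close> form an e-collection: this is exactly
  the error control assumption. In (2), a set \<open>R\<close> is admitted for \<open>f\<close> only if
  \<open>f S R \<le> \<alpha> E S\<close>, so \<open>\<alpha> E S\<close> dominates the supremum of the errors over all \<open>f\<close> at once.
\<close>

lemma true_hyps_in_Pow: "true_hyps m H P \<in> Pow {1..m}"
  by (auto simp: true_hyps_def)

text \<open>\<open>Max\<close> carries its intended meaning only on finite nonempty sets. Each value
  of a random collection is a family of subsets of \<open>{1..m}\<close>, which gives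
  finiteness.\<close>

lemma random_collection_finite:
  assumes "random_collection \<Omega> m C" "\<omega> \<in> space \<Omega>"
  shows "C \<omega> \<subseteq> Pow {1..m}" "finite (C \<omega>)" "C \<omega> \<noteq> {}"
proof -
  show sub: "C \<omega> \<subseteq> Pow {1..m}"
    using assms measurable_space[of C \<Omega> "count_space (Pow (Pow {1..m}))" \<omega>]
    by (auto simp: random_collection_def)
  show "finite (C \<omega>)"
    by (rule finite_subset[OF sub]) simp
  show "C \<omega> \<noteq> {}"
    using assms by (simp add: random_collection_def)
qed

text \<open>For countable \<open>F\<close> this is automatic: each inner maximum depends on the
  outcome only through \<open>C f\<close>, and countable suprema preserve measurability. The
  uncountable case is exactly what \<open>measurable_suprema\<close> supplies.\<close>

lemma borel_measurable_sup_error: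
  assumes C: "\<And>f. f \<in> F \<Longrightarrow> random_collection \<Omega> m (C f)"
    and F: "measurable_suprema \<Omega> m F C"
    and S: "S \<in> Pow {1..m}"
  shows "sup_error F C S \<in> borel_measurable \<Omega>"
proof (cases "countable F")
  case True
  have "(\<lambda>\<omega>. ennreal (MAX R\<in>C f \<omega>. f S R)) \<in> borel_measurable \<Omega>" if "f \<in> F" for f
  \<comment> \<open>Every function on a discrete space is measurable, so only the measurability of
    \<open>C f\<close> remains to be shown.\<close>
  proof (rule measurable_compose[of "C f" \<Omega> "count_space (Pow (Pow {1..m}))"])
    show "C f \<in> measurable \<Omega> (count_space (Pow (Pow {1..m})))"
      using C[OF that] by (simp add: random_collection_def)
  qed simp
  then have "(\<lambda>\<omega>. SUP f\<in>F. ennreal (MAX R\<in>C f \<omega>. f S R)) \<in> borel_measurable \<Omega>"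
    using True by (intro borel_measurable_SUP)
  then show ?thesis
    by (simp add: sup_error_def[abs_def])
next
  case False
  then show ?thesis
    using F S by (simp add: measurable_suprema_def)
qed

lemma error_le_sup_error:
  assumes "f \<in> F" "finite (C f \<omega>)" "R \<in> C f \<omega>"
  shows "ennreal (f S R) \<le> sup_error F C S \<omega>"
proof -
  have "ennreal (f S R) \<le> ennreal (MAX R\<in>C f \<omega>. f S R)"
    using assms by (intro ennreal_leI Max_ge) auto
  also have "\<dots> \<le> sup_error F C S \<omega>"
    unfolding sup_error_def by (rule SUP_upper[OF assms(1)])
  finally show ?thesis .
qed

text \<open>Each maximum is attained at some \<open>R\<close> in \<open>C f \<omega>\<close>, so a
  bound that is uniform in \<open>f\<close> and \<open>R\<close> passes to the supremum.\<close>

lemma sup_error_le: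
  assumes "\<And>f. f \<in> F \<Longrightarrow> finite (C f \<omega>) \<and> C f \<omega> \<noteq> {}"
    and "\<And>f R. f \<in> F \<Longrightarrow> R \<in> C f \<omega> \<Longrightarrow> ennreal (f S R) \<le> b"
  shows "sup_error F C S \<omega> \<le> b"
  unfolding sup_error_def
proof (rule SUP_least)
  fix f assume f: "f \<in> F"
  then have "(MAX R\<in>C f \<omega>. f S R) \<in> f S ` C f \<omega>"
    using assms(1)[OF f] by (intro Max_in) auto
  then show "ennreal (MAX R\<in>C f \<omega>. f S R) \<le> b"
    using assms(2)[OF f] by auto
qed

text \<open>Error functions vanish at \<open>N = {}\<close>. This yields the convention that the
  e-value of the empty set is 0 for the e-collection built in (1).\<close>

lemma sup_error_empty:
  assumes F: "\<And>f. f \<in> F \<Longrightarrow> error_function m f"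
    and C: "\<And>f. f \<in> F \<Longrightarrow> random_collection \<Omega> m (C f)"
    and \<omega>: "\<omega> \<in> space \<Omega>"
  shows "sup_error F C {} \<omega> = 0"
proof -
  have "sup_error F C {} \<omega> \<le> 0"
  proof (rule sup_error_le)
    fix f assume f: "f \<in> F"
    note fin = random_collection_finite[OF C[OF f] \<omega>]
    show "finite (C f \<omega>) \<and> C f \<omega> \<noteq> {}"
      using fin by simp
    show "ennreal (f {} R) \<le> 0" if "R \<in> C f \<omega>" for R
      using F[OF f] fin(1) that by (auto simp: error_function_def)
  qed
  then show ?thesis by simp
qed

text \<open>The target is finite, so preimages of singletons suffice. The event that the collection
  equals \<open>A\<close> is a finite Boolean combination of threshold events for the variables
  \<open>E S\<close>.\<close>

lemma measurable_ER_collection: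
  assumes E: "\<And>S. S \<in> Pow {1..m} \<Longrightarrow> E S \<in> borel_measurable \<Omega>"
  shows "ER_collection m \<alpha> E f \<in> measurable \<Omega> (count_space (Pow (Pow {1..m})))"
proof -
  have sub: "ER_collection m \<alpha> E f \<omega> \<subseteq> Pow {1..m}" for \<omega>
    unfolding ER_collection_def by blast
  have "ER_collection m \<alpha> E f -` {A} \<inter> space \<Omega> \<in> sets \<Omega>" if "A \<in> Pow (Pow {1..m})" for A
  proof -
    have "{\<omega> \<in> space \<Omega>. E S \<omega> \<ge> ennreal (f S R / \<alpha>)} \<in> sets \<Omega>" if "S \<in> Pow {1..m}" for S R
      using E[OF that] by (intro borel_measurable_le borel_measurable_const)
    then have mem: "{\<omega> \<in> space \<Omega>. \<forall>S\<in>Pow {1..m}. E S \<omega> \<ge> ennreal (f S R / \<alpha>)} \<in> sets \<Omega>" for R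
      by (intro sets.sets_Collect_finite_All') auto
    have iff: "R \<in> ER_collection m \<alpha> E f \<omega> \<longleftrightarrow> (\<forall>S\<in>Pow {1..m}. E S \<omega> \<ge> ennreal (f S R / \<alpha>))"
      if "R \<in> Pow {1..m}" for R \<omega>
      using that by (simp add: ER_collection_def)
    have "{\<omega> \<in> space \<Omega>. R \<in> ER_collection m \<alpha> E f \<omega> \<longleftrightarrow> R \<in> A} \<in> sets \<Omega>"
      if "R \<in> Pow {1..m}" for R
      using mem[of R] sets.sets_Collect_neg[OF mem[of R]]
      unfolding iff[OF that] by (cases "R \<in> A") simp_all
    then have "{\<omega> \<in> space \<Omega>. \<forall>R\<in>Pow {1..m}. R \<in> ER_collection m \<alpha> E f \<omega> \<longleftrightarrow> R \<in> A} \<in> sets \<Omega>"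
      by (intro sets.sets_Collect_finite_All') auto
    also have "{\<omega> \<in> space \<Omega>. \<forall>R\<in>Pow {1..m}. R \<in> ER_collection m \<alpha> E f \<omega> \<longleftrightarrow> R \<in> A}
        = ER_collection m \<alpha> E f -` {A} \<inter> space \<Omega>"
    proof -
      \<comment> \<open>Agreement on \<open>Pow {1..m}\<close> is equality because both families are
        contained in it.\<close>
      from sub that have "(\<forall>R\<in>Pow {1..m}. R \<in> ER_collection m \<alpha> E f \<omega> \<longleftrightarrow> R \<in> A)
          \<longleftrightarrow> ER_collection m \<alpha> E f \<omega> = A" for \<omega>
        by blast
      then show ?thesis by auto
    qed
    finally show ?thesis .
  qed
  then show ?thesis
    using sub by (simp add: measurable_count_space_eq2 Pi_iff)
qed

lemma random_collection_ER_collection: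
  assumes E: "\<And>S. S \<in> Pow {1..m} \<Longrightarrow> E S \<in> borel_measurable \<Omega>"
    and f: "error_function m f"
  shows "random_collection \<Omega> m (ER_collection m \<alpha> E f)"
proof -
  \<comment> \<open>Since \<open>f S {} = 0\<close>, every threshold for the empty discovery set is
    0.\<close>
  have "{} \<in> ER_collection m \<alpha> E f \<omega>" for \<omega>
    using f by (simp add: ER_collection_def error_function_def)
  then show ?thesis
    using measurable_ER_collection[of m E, OF E] by (auto simp: random_collection_def)
qed

text \<open>Membership of \<open>R\<close> imposes a constraint for every \<open>S\<close>; reading
  off the one at the given \<open>S\<close> bounds the error by a quantity that involves neither
  \<open>f\<close> nor \<open>R\<close>.\<close>

lemma sup_error_ER_collection_le:
  assumes \<alpha>: "\<alpha> > 0"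
    and F: "\<And>f. f \<in> F \<Longrightarrow> error_function m f"
    and S: "S \<in> Pow {1..m}"
  shows "sup_error F (ER_collection m \<alpha> E) S \<omega> \<le> ennreal \<alpha> * E S \<omega>"
proof (rule sup_error_le)
  fix f assume f: "f \<in> F"
  have "{} \<in> ER_collection m \<alpha> E f \<omega>"
    using F[OF f] by (simp add: ER_collection_def error_function_def)
  moreover have "finite (ER_collection m \<alpha> E f \<omega>)"
    by (simp add: ER_collection_def)
  ultimately show "finite (ER_collection m \<alpha> E f \<omega>) \<and> ER_collection m \<alpha> E f \<omega> \<noteq> {}"
    by auto
  fix R assume R: "R \<in> ER_collection m \<alpha> E f \<omega>"
  then have "0 \<le> f S R" "ennreal (f S R / \<alpha>) \<le> E S \<omega>"
    using F[OF f] S by (auto simp: ER_collection_def error_function_def)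
  moreover have "ennreal (f S R) = ennreal \<alpha> * ennreal (f S R / \<alpha>)"
    using \<alpha> \<open>0 \<le> f S R\<close> by (simp flip: ennreal_mult)
  ultimately show "ennreal (f S R) \<le> ennreal \<alpha> * E S \<omega>"
    by (simp add: mult_left_mono)
qed

theorem theorem41:
  fixes \<Omega> :: "'w measure"
    and M :: "'w measure set"
    and m :: nat
    and H :: "nat \<Rightarrow> 'w measure set"
    and \<alpha> :: real
    and F :: "error_fun set"
  assumes "\<And>P. P \<in> M \<Longrightarrow> prob_space P"
    and "\<And>P. P \<in> M \<Longrightarrow> sets P = sets \<Omega>"
    and "m \<ge> 1"
    and "\<And>i. i \<in> {1..m} \<Longrightarrow> H i \<subseteq> M"
    and "\<alpha> > 0"
    and "\<And>f. f \<in> F \<Longrightarrow> error_function m f"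
  shows "(\<forall>C :: error_fun \<Rightarrow> 'w \<Rightarrow> nat set set.
            measurable_suprema \<Omega> m F C \<longrightarrow>
            simultaneous_error_control \<Omega> M m H \<alpha> F C \<longrightarrow>
            (\<exists>E. e_collection \<Omega> M m H E \<and>
               (\<forall>f\<in>F. \<forall>\<omega>\<in>space \<Omega>. C f \<omega> \<subseteq> ER_collection m \<alpha> E f \<omega>))) \<and>
         (\<forall>E. e_collection \<Omega> M m H E \<longrightarrow>
            measurable_suprema \<Omega> m F (ER_collection m \<alpha> E) \<longrightarrow>
            simultaneous_error_control \<Omega> M m H \<alpha> F (ER_collection m \<alpha> E))"
proof (intro conjI allI impI)
  fix C :: "error_fun \<Rightarrow> 'w \<Rightarrow> nat set set"
  assume meas: "measurable_suprema \<Omega> m F C"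
    and ctrl: "simultaneous_error_control \<Omega> M m H \<alpha> F C"
  have C: "random_collection \<Omega> m (C f)" if "f \<in> F" for f
    using ctrl that by (simp add: simultaneous_error_control_def)
  note sup_meas = borel_measurable_sup_error[OF C meas]
  \<comment> \<open>This is the pointwise smallest choice satisfying all the constraints
    \<open>f S R / \<alpha> \<le> E S \<omega>\<close> with \<open>f \<in> F\<close> and
    \<open>R \<in> C f \<omega>\<close>.\<close>
  define E where "E = (\<lambda>S \<omega>. sup_error F C S \<omega> / ennreal \<alpha>)"
  have "e_collection \<Omega> M m H E"
    unfolding e_collection_def
  proof (intro conjI ballI)
    show "E S \<in> borel_measurable \<Omega>" if "S \<in> Pow {1..m}" for S
      using sup_meas[OF _ that] by (simp add: E_def)
    show "E {} \<omega> = 0" if "\<omega> \<in> space \<Omega>" for \<omega>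
      using sup_error_empty[OF assms(6) C that] by (simp add: E_def)
    fix P assume P: "P \<in> M"
    let ?N = "true_hyps m H P"
    \<comment> \<open>Measurability transfers from \<open>\<Omega>\<close> to \<open>P\<close>
      because their sigma-algebras agree; it allows the constant \<open>\<alpha>\<close> to be
      pulled out of the integral.\<close>
    have "sup_error F C ?N \<in> borel_measurable P"
      using sup_meas[OF _ true_hyps_in_Pow]
      by (simp cong: measurable_cong_sets add: assms(2)[OF P])
    then have "(\<integral>\<^sup>+ \<omega>. E ?N \<omega> \<partial>P) = (\<integral>\<^sup>+ \<omega>. sup_error F C ?N \<omega> \<partial>P) / ennreal \<alpha>"
      unfolding E_def by (rule nn_integral_divide)
    also have "\<dots> \<le> ennreal \<alpha> / ennreal \<alpha>"
      using ctrl P by (intro divide_right_mono_ennreal) (simp add: simultaneous_error_control_def)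
    also have "\<dots> = 1"
      using assms(5) by (simp add: divide_ennreal)
    finally show "(\<integral>\<^sup>+ \<omega>. E ?N \<omega> \<partial>P) \<le> 1" .
  qed
  moreover have "C f \<omega> \<subseteq> ER_collection m \<alpha> E f \<omega>" if f: "f \<in> F" and \<omega>: "\<omega> \<in> space \<Omega>" for f \<omega>
  proof
    fix R assume R: "R \<in> C f \<omega>"
    note fin = random_collection_finite[OF C[OF f] \<omega>]
    have "ennreal (f S R / \<alpha>) \<le> E S \<omega>" if S: "S \<in> Pow {1..m}" for S
    proof -
      \<comment> \<open>Error functions are constrained only at subsets of \<open>{1..m}\<close>, so
        the sign of \<open>f S R\<close> rests on the values of \<open>C f\<close> being families of
        such subsets.\<close>
      have "0 \<le> f S R"
        using assms(6)[OF f] R fin(1) S unfolding error_function_def by blast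
      then have "ennreal (f S R / \<alpha>) = ennreal (f S R) / ennreal \<alpha>"
        using assms(5) by (simp add: divide_ennreal)
      also have "\<dots> \<le> E S \<omega>"
        unfolding E_def
        by (intro divide_right_mono_ennreal error_le_sup_error f fin(2) R)
      finally show ?thesis .
    qed
    then show "R \<in> ER_collection m \<alpha> E f \<omega>"
      using R fin(1) by (auto simp: ER_collection_def)
  qed
  ultimately show "\<exists>E. e_collection \<Omega> M m H E \<and>
      (\<forall>f\<in>F. \<forall>\<omega>\<in>space \<Omega>. C f \<omega> \<subseteq> ER_collection m \<alpha> E f \<omega>)"
    by blast
next
  fix E assume E: "e_collection \<Omega> M m H E"
  then have E_meas: "E S \<in> borel_measurable \<Omega>" if "S \<in> Pow {1..m}" for S
    using that unfolding e_collection_def by blast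
  show "simultaneous_error_control \<Omega> M m H \<alpha> F (ER_collection m \<alpha> E)"
    unfolding simultaneous_error_control_def
  proof (intro conjI ballI)
    show "random_collection \<Omega> m (ER_collection m \<alpha> E f)" if "f \<in> F" for f
      using E_meas assms(6)[OF that] by (rule random_collection_ER_collection)
    fix P assume P: "P \<in> M"
    let ?N = "true_hyps m H P"
    have "E ?N \<in> borel_measurable P"
      using E_meas[OF true_hyps_in_Pow]
      by (simp cong: measurable_cong_sets add: assms(2)[OF P])
    \<comment> \<open>The pointwise bound holds for every \<open>S\<close>, so it may be applied at
      the unknown set of true hypotheses; the e-collection property then bounds the integral of
      \<open>E ?N\<close> by 1.\<close>
    have "(\<integral>\<^sup>+ \<omega>. sup_error F (ER_collection m \<alpha> E) ?N \<omega> \<partial>P) \<le> (\<integral>\<^sup>+ \<omega>. ennreal \<alpha> * E ?N \<omega> \<partial>P)"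
      by (intro nn_integral_mono sup_error_ER_collection_le[OF assms(5,6) true_hyps_in_Pow])
    also have "\<dots> = ennreal \<alpha> * (\<integral>\<^sup>+ \<omega>. E ?N \<omega> \<partial>P)"
      by (rule nn_integral_cmult) fact
    also have "\<dots> \<le> ennreal \<alpha> * 1"
      using E P by (intro mult_left_mono) (auto simp: e_collection_def)
    finally show "(\<integral>\<^sup>+ \<omega>. sup_error F (ER_collection m \<alpha> E) ?N \<omega> \<partial>P) \<le> ennreal \<alpha>"
      by simp
  qed
qed

end
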